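(* Let $G_{hex}$ be the infinite hexagonal grid. There exists a universal constant $c<1$ such that, whenever only finitely many vertices of $G_{hex}$ are burning, there exist a vertex $v_0\in V(G_{hex})$ and a strategy for one firefighter (protecting one vertex per turn) such that for every large enough $T$ all vertices burning after turn $T$ are contained in $N_{\le c\cdot T}(v_0)$.
   Context: $G_{hex}$ is the infinite 3-regular graph formed by the vertices and edges of the tiling of the plane by regular hexagons. Firefighter process: in each turn, the firefighter first protects one vertex which is not yet on fire, and then the fire spreads to all unprotected neighbors of the vertices already on fire. Once a vertex is on fire or is protected it stays in that state forever. Here the process starts from an arbitrary position in which finitely many vertices are burning; the constant $c$ does not depend on this position, while $v_0$, the strategy and how large $T$ has to be may depend on it. $N_{\le t}(v)=\{x\in V(G): d_G(x,v)\le t\}$, where $d_G$ is the graph distance. *)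

theory Defs
  imports Complex_Main "HOL-Library.Extended_Real"
begin

text \<open>An undirected simple graph is given by a vertex set and a set of two-element edges.\<close>

definition edge_rel :: "'a set set \<Rightarrow> ('a \<times> 'a) set" where
  "edge_rel E = {(x, y). {x, y} \<in> E}"

text \<open>The power \<open>edge_rel E ^^ n\<close> relates the endpoints of walks of length \<open>n\<close>;
  the distance is \<open>\<infinity>\<close> if there is no walk.\<close>

definition graph_dist :: "'a set set \<Rightarrow> 'a \<Rightarrow> 'a \<Rightarrow> enat" where
  "graph_dist E x y = (INF n\<in>{n. (x, y) \<in> edge_rel E ^^ n}. enat n)"

definition graph_nbhd :: "'a set \<Rightarrow> 'a set set \<Rightarrow> real \<Rightarrow> 'a \<Rightarrow> 'a set" where
  "graph_nbhd V E t v = {x \<in> V. ereal_of_enat (graph_dist E x v) \<le> ereal t}"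

text \<open>The tiling consists of the hexagons of side length 1 with corners
  \<open>z + hex_corner k\<close> (\<open>k < 6\<close>), where the centres \<open>z\<close> run through the triangular lattice spanned
  by two vectors of length \<open>sqrt 3\<close> at angle \<open>pi / 3\<close>, each leading from a centre to the centre
  of a hexagon sharing a side.\<close>

definition hex_corner :: "nat \<Rightarrow> complex" where
  "hex_corner k = cis (real k * pi / 3)"

definition hex_centres :: "complex set" where
  "hex_centres = {of_int a * (hex_corner 0 + hex_corner 1) + of_int b * (hex_corner 1 + hex_corner 2)
                  | a b :: int. True}"

definition hex_vertices :: "complex set" where
  "hex_vertices = {z + hex_corner k | z k. z \<in> hex_centres \<and> k < 6}"

definition hex_edges :: "complex set set" where
  "hex_edges = {{z + hex_corner k, z + hex_corner (Suc k)} | z k. z \<in> hex_centres \<and> k < 6}"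

text \<open>Turns are numbered from 1, and \<open>p t\<close> is the vertex protected in turn \<open>t\<close> (\<open>p 0\<close> is unused).
  As the process is deterministic, a strategy for a given initial position is such a sequence.
  The set \<open>burning E B p t\<close> consists of the vertices on fire after turn \<open>t\<close>, starting
  from \<open>B\<close>; in turn \<open>Suc t\<close>, the vertex \<open>p (Suc t)\<close> is already protected when the fire spreads.\<close>

primrec burning :: "'a set set \<Rightarrow> 'a set \<Rightarrow> (nat \<Rightarrow> 'a) \<Rightarrow> nat \<Rightarrow> 'a set" where
  "burning E B p 0 = B"
| "burning E B p (Suc t) =
     burning E B p t \<union> {x. x \<notin> p ` {1..Suc t} \<and> (\<exists>y\<in>burning E B p t. {x, y} \<in> E)}"

definition strategy :: "'a set \<Rightarrow> 'a set set \<Rightarrow> 'a set \<Rightarrow> (nat \<Rightarrow> 'a) \<Rightarrow> bool" where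
  "strategy V E B p \<longleftrightarrow> (\<forall>t. p (Suc t) \<in> V - burning E B p t)"

end

theory Submission imports Defs begin

text \<open>The fire advances one edge per turn, but a barrier advances at twice that speed: vertices of one
  bipartition class that lie on a line in a lattice direction are at distance two from each other,
  and protecting all of them on a segment leaves no way through it. With this advantage the
  firefighter draws a hexagonal spiral around the initial fire. Side \<open>j\<close> of the spiral lies at
  distance about \<open>8 * m * 4 ^ j\<close> from the centre, where \<open>m\<close> exceeds the radius of the initial fire.
  The length of the spiral up to the point of a side that the fire threatens first is less than
  twice the distance of that point, so each vertex is protected before even an unhindered fire
  could reach it (\<open>build_time_le\<close>).

  The fire is therefore confined to the channel between consecutive turns of the spiral and has to
  run along it. The distance to the centre is, up to a constant, the maximum of six functions
  \<open>level k\<close>, one for each side direction, and each of them changes by exactly one along every edge.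
  Outside side \<open>j\<close> the arrival time of the fire is at least \<open>level (j + 1)\<close> plus the sum
  of the distances of the sides before \<open>j\<close>: turning the corner at the end of side \<open>j\<close> replaces
  \<open>level (j + 1)\<close> by \<open>level (j + 2)\<close>, which is smaller by the distance of side \<open>j\<close>, and this
  loss is a detour for the fire. Lemma \<open>fire_step\<close> proves this lower bound for the arrival time
  by inspecting single edges, so no planar topology enters.

  The accumulated detour grows like \<open>4 ^ j\<close>, and so does the distance from the centre at which
  the channel is left behind by the next turn of the spiral. Hence arrival times exceed distances
  by a fixed proportion (\<open>fire_retarded\<close>), which is the claim.\<close>

section \<open>Eisenstein coordinates for the hexagonal grid\<close>

text \<open>The corners of the tiling together with the centres form the triangular lattice of Eisenstein
  integers, and the centres are the sublattice where the coordinate difference is divisible by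
  three.\<close>

definition eis :: "int \<times> int \<Rightarrow> complex" where
  "eis p = of_int (fst p) + of_int (snd p) * cis (pi / 3)"

definition honeycomb :: "(int \<times> int) set" where
  "honeycomb = {p. (fst p - snd p) mod 3 \<noteq> 0}"

text \<open>Every neighbour in the triangular lattice that is not a hexagon centre is a neighbour in the
  grid, so adjacency needs no reference to hexagons.\<close>

definition hex_adj :: "int \<times> int \<Rightarrow> int \<times> int \<Rightarrow> bool" where
  "hex_adj p q \<longleftrightarrow> p \<in> honeycomb \<and> q \<in> honeycomb \<and>
     (fst q - fst p, snd q - snd p) \<in> {(1,0), (0,1), (-1,1), (-1,0), (0,-1), (1,-1)}"

lemma hex_adj_sym: "hex_adj p q \<Longrightarrow> hex_adj q p"
proof -
  assume a: "hex_adj p q"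
  obtain d e where de: "d = fst q - fst p" "e = snd q - snd p" by simp
  have "(d, e) \<in> {(1,0), (0,1), (-1,1), (-1,0), (0,-1), (1,-1)}"
    using a by (simp add: hex_adj_def de)
  then have "(- d, - e) \<in> {(1,0), (0,1), (-1,1), (-1,0), (0,-1), (1,-1)}"
    by (elim insertE emptyE; simp)
  then show "hex_adj q p" using a by (simp only: hex_adj_def de minus_diff_eq)
qed

lemma cis_sixth: "cis (pi / 3) = Complex (1/2) (sqrt 3 / 2)"
  by (simp add: complex_eq_iff cos_60 sin_60)

lemma eis_inject [simp]: "eis p = eis q \<longleftrightarrow> p = q"
proof
  assume h: "eis p = eis q"
  have "Im (eis p) = Im (eis q)" "Re (eis p) = Re (eis q)" using h by simp_all
  then show "p = q"
    by (cases p; cases q) (auto simp: eis_def cis_sixth)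
qed simp

lemma hex_corner_eis:
  "hex_corner 0 = eis (1, 0)" "hex_corner (Suc 0) = eis (0, 1)" "hex_corner 2 = eis (-1, 1)"
  "hex_corner 3 = eis (-1, 0)" "hex_corner 4 = eis (0, -1)" "hex_corner 5 = eis (1, -1)"
  "hex_corner 6 = eis (1, 0)"
proof -
  have pow: "hex_corner k = cis (pi / 3) ^ k" for k
    by (simp add: hex_corner_def DeMoivre)
  have sq: "cis (pi / 3) ^ 2 = cis (pi / 3) - 1"
    by (simp add: cis_sixth power2_eq_square complex_eq_iff)
  have s3: "cis (pi / 3) ^ 3 = -1"
    by (simp add: cis_sixth power3_eq_cube complex_eq_iff)
  have s4: "cis (pi / 3) ^ 4 = - cis (pi / 3)"
    using s3 power_add[of "cis (pi/3)" 3 1] by simp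
  have s5: "cis (pi / 3) ^ 5 = 1 - cis (pi / 3)"
    using s3 sq power_add[of "cis (pi/3)" 3 2] by simp
  have s6: "cis (pi / 3) ^ 6 = 1"
    using s3 power_add[of "cis (pi/3)" 3 3] by simp
  show "hex_corner 0 = eis (1, 0)" "hex_corner (Suc 0) = eis (0, 1)" "hex_corner 2 = eis (-1, 1)"
    "hex_corner 3 = eis (-1, 0)" "hex_corner 4 = eis (0, -1)" "hex_corner 5 = eis (1, -1)"
    "hex_corner 6 = eis (1, 0)"
    by (simp_all add: pow eis_def sq s3 s4 s5 s6)
qed

lemma eis_add: "eis p + eis q = eis (fst p + fst q, snd p + snd q)"
  by (simp add: eis_def algebra_simps)

lemma hex_centres_eis: "hex_centres = eis ` {p. (fst p - snd p) mod 3 = 0}"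
proof -
  have gen: "of_int a * (hex_corner 0 + hex_corner 1) + of_int b * (hex_corner 1 + hex_corner 2)
        = eis (a - b, a + 2 * b)" for a b
    by (simp add: hex_corner_eis eis_add) (simp add: eis_def algebra_simps)
  show ?thesis
  proof (intro equalityI subsetI)
    fix z assume "z \<in> hex_centres"
    then obtain a b where "z = eis (a - b, a + 2 * b)"
      unfolding hex_centres_def gen by auto
    moreover have "(a - b - (a + 2 * b)) mod 3 = 0" by presburger
    ultimately show "z \<in> eis ` {p. (fst p - snd p) mod 3 = 0}" by auto
  next
    fix z assume "z \<in> eis ` {p. (fst p - snd p) mod 3 = 0}"
    then obtain c d where z: "z = eis (c, d)" "(c - d) mod 3 = 0" by auto
    then obtain b where "d - c = 3 * b" by (metis dvd_def mod_0_imp_dvd dvd_diff_commute)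
    then have "z = eis ((c + b) - b, (c + b) + 2 * b)" using z by (simp add: algebra_simps)
    then show "z \<in> hex_centres" unfolding hex_centres_def gen by blast
  qed
qed

lemma less_6_cases: "(k::nat) < 6 \<Longrightarrow> k = 0 \<or> k = Suc 0 \<or> k = 2 \<or> k = 3 \<or> k = 4 \<or> k = 5"
  by auto

lemma hex_vertices_eis: "hex_vertices = eis ` honeycomb"
proof (intro equalityI subsetI)
  fix x assume "x \<in> hex_vertices"
  then obtain w k where "w \<in> hex_centres" "k < 6" "x = w + hex_corner k"
    unfolding hex_vertices_def by blast
  moreover from this(1) obtain z where "w = eis z" "(fst z - snd z) mod 3 = 0"
    unfolding hex_centres_eis by (elim imageE) simp
  ultimately have "(fst z - snd z) mod 3 = 0" "k < 6" "x = eis z + hex_corner k" by simp_all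
  then obtain c d where k: "k < 6" and m: "(c - d) mod 3 = 0" and x: "x = eis (c, d) + hex_corner k"
    by (metis prod.collapse)
  obtain p where p: "hex_corner k = eis p" "(fst p - snd p) mod 3 \<noteq> 0"
    using less_6_cases[OF k] hex_corner_eis by force
  have "(c - d + (fst p - snd p)) mod 3 \<noteq> 0" using m p(2) by presburger
  then have "(c + fst p, d + snd p) \<in> honeycomb" by (simp add: honeycomb_def algebra_simps)
  then show "x \<in> eis ` honeycomb" unfolding x p(1) eis_add by simp
next
  fix x assume "x \<in> eis ` honeycomb"
  then obtain a b where x: "x = eis (a, b)" and ab: "(a - b) mod 3 \<noteq> 0"
    by (auto simp: honeycomb_def)
  then have "(a - 1 - b) mod 3 = 0 \<or> (a + 1 - b) mod 3 = 0" by presburger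
  then consider "(a - 1 - b) mod 3 = 0" | "(a + 1 - b) mod 3 = 0" by blast
  then show "x \<in> hex_vertices"
  proof cases
    case 1
    then have "eis (a - 1, b) \<in> hex_centres" by (simp add: hex_centres_eis)
    moreover have "x = eis (a - 1, b) + hex_corner 0" by (simp add: x hex_corner_eis eis_add)
    ultimately show ?thesis unfolding hex_vertices_def by force
  next
    case 2
    then have "eis (a + 1, b) \<in> hex_centres" by (simp add: hex_centres_eis)
    moreover have "x = eis (a + 1, b) + hex_corner 3" by (simp add: x hex_corner_eis eis_add)
    ultimately show ?thesis unfolding hex_vertices_def by force
  qed
qed

lemma hex_edge_cases:
  assumes "{x, y} \<in> hex_edges"
  obtains p q where "x = eis p" "y = eis q" "hex_adj p q"
proof -
  obtain w k where "w \<in> hex_centres" "k < 6"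
    "{x, y} = {w + hex_corner k, w + hex_corner (Suc k)}"
    using assms unfolding hex_edges_def by blast
  moreover from this(1) obtain z where "w = eis z" "(fst z - snd z) mod 3 = 0"
    unfolding hex_centres_eis by (elim imageE) simp
  ultimately have "(fst z - snd z) mod 3 = 0" "k < 6"
    "{x, y} = {eis z + hex_corner k, eis z + hex_corner (Suc k)}" by simp_all
  then obtain c d where k: "k < 6" and m: "(c - d) mod 3 = 0"
    and xy: "{x, y} = {eis (c, d) + hex_corner k, eis (c, d) + hex_corner (Suc k)}"
    by (metis prod.collapse)
  have "\<exists>p q. eis (c, d) + hex_corner k = eis p \<and> eis (c, d) + hex_corner (Suc k) = eis q
      \<and> hex_adj p q"
  proof -
    have m': "(c - d + 1) mod 3 \<noteq> 0" "(c - d - 1) mod 3 \<noteq> 0" "(c - d + 2) mod 3 \<noteq> 0"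
      "(c - d - 2) mod 3 \<noteq> 0" using m by presburger+
    show ?thesis
      using less_6_cases[OF k]
    proof (elim disjE)
      assume "k = 0"
      then show ?thesis using m'
        by (intro exI[of _ "(c + 1, d)"] exI[of _ "(c, d + 1)"])
          (simp add: hex_corner_eis eis_add hex_adj_def honeycomb_def algebra_simps)
    next
      assume "k = Suc 0"
      then show ?thesis using m'
        by (intro exI[of _ "(c, d + 1)"] exI[of _ "(c - 1, d + 1)"])
          (simp add: hex_corner_eis eis_add hex_adj_def honeycomb_def algebra_simps
            numeral_2_eq_2[symmetric])
    next
      assume "k = 2"
      then show ?thesis using m'
        by (intro exI[of _ "(c - 1, d + 1)"] exI[of _ "(c - 1, d)"])
          (simp add: hex_corner_eis eis_add hex_adj_def honeycomb_def algebra_simps)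
    next
      assume "k = 3"
      then show ?thesis using m'
        by (intro exI[of _ "(c - 1, d)"] exI[of _ "(c, d - 1)"])
          (simp add: hex_corner_eis eis_add hex_adj_def honeycomb_def algebra_simps)
    next
      assume "k = 4"
      then show ?thesis using m'
        by (intro exI[of _ "(c, d - 1)"] exI[of _ "(c + 1, d - 1)"])
          (simp add: hex_corner_eis eis_add hex_adj_def honeycomb_def algebra_simps)
    next
      assume "k = 5"
      then show ?thesis using m'
        by (intro exI[of _ "(c + 1, d - 1)"] exI[of _ "(c + 1, d)"])
          (simp add: hex_corner_eis eis_add hex_adj_def honeycomb_def algebra_simps)
    qed
  qed
  then show thesis using that xy hex_adj_sym by (metis doubleton_eq_iff)
qed

lemma hex_edgeI:
  assumes "hex_adj p q"
  shows "{eis p, eis q} \<in> hex_edges"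
proof -
  have main: "{eis p, eis q} \<in> hex_edges"
    if a: "hex_adj p q" and r: "(fst p - snd p) mod 3 = 1" for p q
  proof -
    obtain a b where p: "p = (a, b)" by force
    have edge: "{eis z + hex_corner k, eis z + hex_corner (Suc k)} \<in> hex_edges"
      if "(fst z - snd z) mod 3 = 0" "k < 6" for z k
    proof -
      have "eis z \<in> hex_centres" using that(1) by (simp add: hex_centres_eis)
      then show ?thesis unfolding hex_edges_def using that(2) by blast
    qed
    consider "q = (a + 1, b)" | "q = (a - 1, b + 1)" | "q = (a, b - 1)"
    proof -
      have "(a - (b + 1)) mod 3 = 0" "(a - 1 - b) mod 3 = 0" "(a + 1 - (b - 1)) mod 3 = 0"
        using r unfolding p fst_conv snd_conv by presburger+
      then show thesis using a p that
        by (cases q) (auto simp: hex_adj_def honeycomb_def algebra_simps)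
    qed
    then show ?thesis
    proof cases
      case 1
      have "(fst (a, b + 1) - snd (a, b + 1)) mod 3 = 0" using r unfolding p fst_conv snd_conv by presburger
      from edge[OF this, of 4] show ?thesis by (simp add: hex_corner_eis eis_add 1 p)
    next
      case 2
      have "(fst (a - 1, b) - snd (a - 1, b)) mod 3 = 0" using r unfolding p fst_conv snd_conv by presburger
      from edge[OF this, of 0] show ?thesis by (simp add: hex_corner_eis eis_add 2 p)
    next
      case 3
      have "(fst (a + 1, b - 1) - snd (a + 1, b - 1)) mod 3 = 0" using r unfolding p fst_conv snd_conv by presburger
      from edge[OF this, of 2] show ?thesis by (simp add: hex_corner_eis eis_add 3 p)
    qed
  qed
  show ?thesis
  proof (cases "(fst p - snd p) mod 3 = 1")
    case True then show ?thesis using main assms by blast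
  next
    case False
    have "hex_adj q p" using assms by (rule hex_adj_sym)
    moreover have "(fst q - snd q) mod 3 = 1"
    proof -
      have p2: "(fst p - snd p) mod 3 = 2" 
        using False assms unfolding hex_adj_def honeycomb_def by auto
      have "(fst q - snd q) mod 3 \<noteq> 2"
        using p2 assms unfolding hex_adj_def by (simp; elim disjE conjE; presburger)
      then show ?thesis using assms unfolding hex_adj_def honeycomb_def by auto
    qed
    ultimately show ?thesis using main[of q p] by (simp add: insert_commute)
  qed
qed

section \<open>Distance levels in the six side directions\<close>

text \<open>The form \<open>hexform k\<close> is constant along one of the directions that lead from a hexagon centre to
  a neighbouring centre. The recursion is rotation by sixty degrees, because \<open>cis (pi / 3) ^ 2 = cis (pi / 3) - 1\<close>.\<close>

fun hexform :: "nat \<Rightarrow> int \<times> int \<Rightarrow> int" where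
  "hexform 0 p = fst p - snd p"
| "hexform (Suc 0) p = 2 * fst p + snd p"
| "hexform (Suc (Suc k)) p = hexform (Suc k) p - hexform k p"

text \<open>An edge changes \<open>hexform k\<close> by one or by two, according to its direction. Rescaling by two
  thirds and rounding down evens this out; the result is a coordinate with unit steps, whose
  level sets are lines of vertices of a single bipartition class.\<close>

definition level :: "nat \<Rightarrow> int \<times> int \<Rightarrow> int" where
  "level k p = 2 * hexform k p div 3"

lemma hexform_mod_3:
  assumes "p \<in> honeycomb"
  shows "hexform k p mod 3 = 1 \<and> hexform (Suc k) p mod 3 = 2
    \<or> hexform k p mod 3 = 2 \<and> hexform (Suc k) p mod 3 = 1"
proof (induction k)
  case 0 then show ?case using assms by (simp add: honeycomb_def; presburger)
next
  case (Suc k) then show ?case by (simp; presburger)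
qed

lemma level_eq_hexform:
  assumes "p \<in> honeycomb"
  shows "3 * level k p = 2 * hexform k p - (if odd (level k p) then 1 else 2)"
proof -
  have "hexform k p mod 3 = 1 \<or> hexform k p mod 3 = 2" using hexform_mod_3[OF assms] by blast
  then show ?thesis unfolding level_def by (simp; presburger)
qed

lemma level_parity:
  assumes "p \<in> honeycomb"
  shows "odd (level (Suc k) p) \<longleftrightarrow> even (level k p)"
  using hexform_mod_3[OF assms, of k] unfolding level_def by presburger

text \<open>The forms add up exactly; the correction is a rounding effect. It vanishes on odd levels, and
  this is why all sides of the spiral are placed on odd levels: there the arrival times on
  the two sides of a corner agree without loss.\<close>

lemma level_sum:
  assumes "p \<in> honeycomb"
  shows "level (Suc k) p = level k p + level (Suc (Suc k)) p + (if odd (level k p) then 0 else 1)"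
  using level_eq_hexform[OF assms, of k] level_eq_hexform[OF assms, of "Suc k"]
    level_eq_hexform[OF assms, of "Suc (Suc k)"] level_parity[OF assms, of k]
    level_parity[OF assms, of "Suc k"]
  by (auto split: if_splits)

lemma level_opposite:
  assumes "p \<in> honeycomb"
  shows "level (k + 3) p = - 1 - level k p"
proof -
  have "hexform (k + 3) p = - hexform k p" by (simp add: numeral_3_eq_3)
  then show ?thesis
    using hexform_mod_3[OF assms, of k] unfolding level_def by presburger
qed

lemma level_period: "level (k + 6) p = level k p"
proof -
  have "hexform (j + 3) p = - hexform j p" for j by (simp add: numeral_3_eq_3)
  from this[of k] this[of "k + 3"] have "hexform (k + 6) p = hexform k p" by (simp add: add.commute)
  then show ?thesis by (simp add: level_def)
qed

text \<open>Only three of the six lattice directions occur at a vertex, depending on its residue class. The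
  pairs of increments of two consecutive forms run through a set that the recursion preserves.\<close>

lemma level_step:
  assumes "hex_adj p q"
  shows "\<bar>level k q - level k p\<bar> = 1"
proof -
  have step: "let d = hexform k q - hexform k p; e = hexform (Suc k) q - hexform (Suc k) p in
      hexform k p mod 3 = 1 \<and> (d, e) \<in> {(1, 2), (-2, -1), (1, -1)}
    \<or> hexform k p mod 3 = 2 \<and> (d, e) \<in> {(-1, -2), (2, 1), (-1, 1)}"
  proof (induction k)
    case 0
    have h: "(fst p - snd p) mod 3 \<noteq> 0" "(fst q - snd q) mod 3 \<noteq> 0"
      using assms by (auto simp: hex_adj_def honeycomb_def)
    then have m: "(fst p - snd p) mod 3 = 1 \<or> (fst p - snd p) mod 3 = 2" by presburger
    have "(fst q - fst p, snd q - snd p) \<in> {(1,0), (0,1), (-1,1), (-1,0), (0,-1), (1,-1)}"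
      using assms by (simp add: hex_adj_def)
    then obtain d e where q: "fst q = fst p + d" "snd q = snd p + e"
      and de: "(d, e) \<in> {(1,0), (0,1), (-1,1), (-1,0), (0,-1), (1,-1)}"
      by (metis add.commute diff_add_cancel)
    have m': "(fst p - snd p + (d - e)) mod 3 \<noteq> 0" using h(2) by (simp add: q algebra_simps)
    define r where "r = (fst p - snd p) mod 3"
    have "r = 1 \<Longrightarrow> d - e \<noteq> - 1 \<and> d - e \<noteq> 2" "r = 2 \<Longrightarrow> d - e \<noteq> 1 \<and> d - e \<noteq> - 2"
      using m' unfolding r_def by presburger+
    then have "r = 1 \<and> (d - e, 2 * d + e) \<in> {(1, 2), (-2, -1), (1, -1)}
      \<or> r = 2 \<and> (d - e, 2 * d + e) \<in> {(-1, -2), (2, 1), (-1, 1)}"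
      using m[folded r_def] de by (elim disjE insertE emptyE; simp)
    then show ?case by (simp add: q r_def algebra_simps)
  next
    case (Suc k)
    moreover have "hexform k p mod 3 = 1 \<and> hexform (Suc k) p mod 3 = 2
        \<or> hexform k p mod 3 = 2 \<and> hexform (Suc k) p mod 3 = 1"
      using assms hexform_mod_3 by (simp add: hex_adj_def)
    moreover define d e where "d = hexform k q - hexform k p"
      and "e = hexform (Suc k) q - hexform (Suc k) p"
    moreover have "hexform (Suc (Suc k)) q - hexform (Suc (Suc k)) p = e - d"
      by (simp add: d_def e_def)
    ultimately show ?case unfolding Let_def by (elim disjE conjE insertE emptyE; simp)
  qed
  define d where "d = hexform k q - hexform k p"
  have d: "hexform k q = hexform k p + d" by (simp add: d_def)
  have "hexform k p mod 3 = 1 \<and> (d = 1 \<or> d = -2) \<or> hexform k p mod 3 = 2 \<and> (d = -1 \<or> d = 2)"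
    using step unfolding Let_def d_def[symmetric] by (elim disjE conjE insertE emptyE) simp_all
  moreover obtain n where "hexform k p = 3 * n + hexform k p mod 3"
    by (metis mult_div_mod_eq)
  ultimately consider "hexform k p = 3 * n + 1" "d = 1 \<or> d = -2"
    | "hexform k p = 3 * n + 2" "d = -1 \<or> d = 2" by auto
  then show ?thesis unfolding level_def d by cases (auto simp: algebra_simps, presburger+)
qed

lemma level_inject:
  assumes "p \<in> honeycomb" "q \<in> honeycomb"
    and "level k p = level k q" "level (Suc k) p = level (Suc k) q"
  shows "p = q"
proof -
  have "hexform k p = hexform k q \<and> hexform (Suc k) p = hexform (Suc k) q"
    using level_eq_hexform[OF assms(1)] level_eq_hexform[OF assms(2)] assms(3,4)
    by (smt (verit))
  then have "hexform 0 p = hexform 0 q \<and> hexform (Suc 0) p = hexform (Suc 0) q"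
    by (induction k) auto
  then show ?thesis by (cases p; cases q) auto
qed

section \<open>Distance to the centre\<close>

text \<open>Three consecutive levels determine all the others, as opposite levels are negatives of each
  other up to a shift by one.\<close>

lemma level_le_iff_window:
  assumes "p \<in> honeycomb"
  shows "(\<forall>k. level k p \<le> n) \<longleftrightarrow> (\<forall>k\<in>{i, Suc i, Suc (Suc i)}. level k p \<in> {- 1 - n..n})"
proof -
  define window where "window j \<longleftrightarrow> (\<forall>k\<in>{j, Suc j, Suc (Suc j)}. level k p \<in> {- 1 - n..n})" for j
  have opp: "level (Suc (Suc (Suc j))) p = - 1 - level j p" for j
    using level_opposite[OF assms, of j] by (simp add: numeral_3_eq_3)
  have "window (Suc j) = window j" for j
    using opp[of j] by (auto simp: window_def)
  then have "window j = window 0" for j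
    by (induction j) simp_all
  moreover have "(\<forall>k. level k p \<le> n) \<longleftrightarrow> (\<forall>j. window j)"
  proof
    assume h: "\<forall>k. level k p \<le> n"
    have "level k p \<in> {- 1 - n..n}" for k
      using h[rule_format, of k] h[rule_format, of "k + 3"] level_opposite[OF assms, of k] by simp
    then show "\<forall>j. window j" by (simp add: window_def)
  qed (auto simp: window_def)
  ultimately have "(\<forall>k. level k p \<le> n) \<longleftrightarrow> window i" by metis
  then show ?thesis by (simp only: window_def)
qed

lemmas level_le_iff = level_le_iff_window[where i = 0, folded numeral_2_eq_2]

text \<open>The two bipartition classes, parametrised so that the levels become linear.\<close>

lemma honeycomb_cases:
  assumes "p \<in> honeycomb"
  obtains t b where "p = (b + 3 * t + 1, b)" | t b where "p = (b + 3 * t + 2, b)"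
proof -
  have "(fst p - snd p) mod 3 = 1 \<or> (fst p - snd p) mod 3 = 2"
    using assms unfolding honeycomb_def mem_Collect_eq by presburger
  moreover have "fst p - snd p = 3 * ((fst p - snd p) div 3) + (fst p - snd p) mod 3" by simp
  ultimately have "p = (snd p + 3 * ((fst p - snd p) div 3) + 1, snd p)
      \<or> p = (snd p + 3 * ((fst p - snd p) div 3) + 2, snd p)"
    unfolding prod_eq_iff fst_conv snd_conv by linarith
  then show thesis using that by blast
qed

lemma level_values:
  "level 0 (b + 3 * t + 1, b) = 2 * t"
  "level (Suc 0) (b + 3 * t + 1, b) = 2 * b + 4 * t + 1"
  "level 2 (b + 3 * t + 1, b) = 2 * b + 2 * t"
  "level 0 (b + 3 * t + 2, b) = 2 * t + 1"
  "level (Suc 0) (b + 3 * t + 2, b) = 2 * b + 4 * t + 2"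
  "level 2 (b + 3 * t + 2, b) = 2 * b + 2 * t + 1"
  by (simp_all add: level_def numeral_2_eq_2; presburger)+

lemma honeycomb_values [simp]:
  "(b + 3 * t + 1, b) \<in> honeycomb" "(b + 3 * t + 2, b) \<in> honeycomb"
  by (simp_all add: honeycomb_def; presburger)+

lemma hex_adj_values:
  "hex_adj (b + 3 * t + 1, b) (b + 3 * t + 2, b)"
  "hex_adj (b + 3 * t + 1, b) ((b + 1) + 3 * (t - 1) + 2, b + 1)"
  "hex_adj (b + 3 * t + 1, b) ((b - 1) + 3 * t + 2, b - 1)"
  unfolding hex_adj_def by (simp_all only: honeycomb_values) simp_all

text \<open>Every edge lowers three consecutive levels and raises the three opposite ones. The levels equal
  to \<open>n + 1\<close>, which have to fall, and those equal to \<open>n\<close>, which must not rise, always lie among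
  three that a common edge lowers. Hence the maximal level bounds the distance to the innermost
  hexagon from above.\<close>

lemma inward_neighbour:
  assumes p: "p \<in> honeycomb" and n: "n \<ge> 1" and le: "\<forall>k. level k p \<le> n + 1"
  obtains q where "hex_adj p q" "\<forall>k. level k q \<le> n"
  using p
proof (cases p rule: honeycomb_cases)
  case (1 t b)
  have h: "- 2 - n \<le> 2 * t" "2 * t \<le> n + 1" "- 2 - n \<le> 2 * b + 4 * t + 1" "2 * b + 4 * t + 1 \<le> n + 1"
    "- 2 - n \<le> 2 * b + 2 * t" "2 * b + 2 * t \<le> n + 1"
    using le[unfolded level_le_iff[OF p], unfolded 1] by (simp_all add: level_values)
  let ?q1 = "(b + 3 * t + 2, b)" and ?q2 = "((b + 1) + 3 * (t - 1) + 2, b + 1)"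
    and ?q3 = "((b - 1) + 3 * t + 2, b - 1)"
  have good: "(\<forall>k. level k (b + 3 * t + 2, b) \<le> n) \<longleftrightarrow>
      - 1 - n \<le> 2 * t + 1 \<and> 2 * t + 1 \<le> n \<and> - 1 - n \<le> 2 * b + 4 * t + 2 \<and> 2 * b + 4 * t + 2 \<le> n \<and>
      - 1 - n \<le> 2 * b + 2 * t + 1 \<and> 2 * b + 2 * t + 1 \<le> n" for b t
    unfolding level_le_iff[OF honeycomb_values(2)] by (simp add: level_values)
  consider "\<forall>k. level k ?q1 \<le> n" | "\<forall>k. level k ?q2 \<le> n" | "\<forall>k. level k ?q3 \<le> n"
    unfolding good using h n by smt
  then show ?thesis using that hex_adj_values[of b t] unfolding 1 by cases blast+
next
  case (2 t b)
  have h: "- 2 - n \<le> 2 * t + 1" "2 * t + 1 \<le> n + 1" "- 2 - n \<le> 2 * b + 4 * t + 2" "2 * b + 4 * t + 2 \<le> n + 1"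
    "- 2 - n \<le> 2 * b + 2 * t + 1" "2 * b + 2 * t + 1 \<le> n + 1"
    using le[unfolded level_le_iff[OF p], unfolded 2] by (simp_all add: level_values)
  let ?q1 = "(b + 3 * t + 1, b)" and ?q2 = "((b - 1) + 3 * (t + 1) + 1, b - 1)"
    and ?q3 = "((b + 1) + 3 * t + 1, b + 1)"
  have good: "(\<forall>k. level k (b + 3 * t + 1, b) \<le> n) \<longleftrightarrow>
      - 1 - n \<le> 2 * t \<and> 2 * t \<le> n \<and> - 1 - n \<le> 2 * b + 4 * t + 1 \<and> 2 * b + 4 * t + 1 \<le> n \<and>
      - 1 - n \<le> 2 * b + 2 * t \<and> 2 * b + 2 * t \<le> n" for b t
    unfolding level_le_iff[OF honeycomb_values(1)] by (simp add: level_values)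
  have adj: "hex_adj p ?q1" "hex_adj p ?q2" "hex_adj p ?q3"
    using hex_adj_values(1)[of b t] hex_adj_values(2)[of "b - 1" "t + 1"] hex_adj_values(3)[of "b + 1" t]
    unfolding 2 by (simp_all add: hex_adj_sym)
  consider "\<forall>k. level k ?q1 \<le> n" | "\<forall>k. level k ?q2 \<le> n" | "\<forall>k. level k ?q3 \<le> n"
    unfolding good using h n by smt
  then show ?thesis using that adj by cases blast+
qed

lemma walk_to_centre:
  assumes "p \<in> honeycomb" "\<forall>k. level k p \<le> 1"
  obtains i where "i \<le> 6" "(eis p, eis (1, 0)) \<in> edge_rel hex_edges ^^ i"
proof -
  have corner_edge: "(hex_corner k, hex_corner (Suc k)) \<in> edge_rel hex_edges" if "k < 6" for k
  proof -
    have "0 \<in> hex_centres" unfolding hex_centres_eis image_iff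
      by (rule bexI[of _ "(0, 0)"]) (simp_all add: eis_def)
    then show ?thesis unfolding hex_edges_def edge_rel_def using that by force
  qed
  have walk: "(hex_corner (6 - i), hex_corner 6) \<in> edge_rel hex_edges ^^ i" if "i \<le> 6" for i
    using that
  proof (induction i)
    case 0 then show ?case by simp
  next
    case (Suc i)
    then have "Suc (6 - Suc i) = 6 - i" by simp
    then show ?case
      using Suc corner_edge[of "6 - Suc i"] by (intro relpow_Suc_I2[of _ "hex_corner (6 - i)"]) auto
  qed
  have "eis p \<in> hex_corner ` {..<6}"
    using assms(1)
  proof (cases p rule: honeycomb_cases)
    case (1 t b)
    have "t = 0 \<and> b = 0 \<or> t = 0 \<and> b = -1 \<or> t = - 1 \<and> b = 1"
      using assms(2)[unfolded level_le_iff[OF assms(1)], unfolded 1] by (simp add: level_values; presburger)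
    then show ?thesis unfolding 1 lessThan_nat_numeral lessThan_Suc
      by (elim disjE) (simp_all add: hex_corner_eis lessThan_nat_numeral lessThan_Suc)
  next
    case (2 t b)
    have "t = -1 \<and> b = 0 \<or> t = 0 \<and> b = -1 \<or> t = - 1 \<and> b = 1"
      using assms(2)[unfolded level_le_iff[OF assms(1)], unfolded 2] by (simp add: level_values; presburger)
    then show ?thesis unfolding 2 lessThan_nat_numeral lessThan_Suc
      by (elim disjE) (simp_all add: hex_corner_eis lessThan_nat_numeral lessThan_Suc)
  qed
  then obtain k where "k < 6" "eis p = hex_corner k" by auto
  then show thesis using walk[of "6 - k"] that[of "6 - k"] by (simp add: hex_corner_eis)
qed

lemma graph_dist_centre_le:
  assumes "p \<in> honeycomb" "\<forall>k. level k p \<le> int n"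
  shows "graph_dist hex_edges (eis p) (eis (1, 0)) \<le> enat (n + 6)"
proof -
  have "\<exists>i\<le>n + 6. (eis p, eis (1, 0)) \<in> edge_rel hex_edges ^^ i"
    using assms
  proof (induction n arbitrary: p rule: less_induct)
    case (less n)
    show ?case
    proof (cases "n \<le> 1")
      case True
      then have "\<forall>k. level k p \<le> 1" using less.prems(2) by (meson of_nat_le_1_iff order_trans)
      then obtain i where "i \<le> 6" "(eis p, eis (1, 0)) \<in> edge_rel hex_edges ^^ i"
        using walk_to_centre less.prems(1) by blast
      then show ?thesis by (intro exI[of _ i]) simp
    next
      case False
      then obtain n' where n: "n = Suc n'" "n' \<ge> 1" by (cases n) auto
      then obtain q where q: "hex_adj p q" "\<forall>k. level k q \<le> int n'"
        using inward_neighbour[of p "int n'"] less.prems by (auto simp: add.commute)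
      then obtain i where "i \<le> n' + 6" "(eis q, eis (1, 0)) \<in> edge_rel hex_edges ^^ i"
        using less.IH[of n' q] n by (auto simp: hex_adj_def)
      moreover have "(eis p, eis q) \<in> edge_rel hex_edges"
        using hex_edgeI[OF q(1)] by (simp add: edge_rel_def)
      ultimately have "Suc i \<le> n + 6 \<and> (eis p, eis (1, 0)) \<in> edge_rel hex_edges ^^ Suc i"
        using n relpow_Suc_I2 by fastforce
      then show ?thesis by blast
    qed
  qed
  then show ?thesis unfolding graph_dist_def
    by (auto intro!: INF_lower2)
qed

section \<open>The spiral and its channel\<close>

text \<open>Level \<open>-1\<close> for the fictitious side \<open>0\<close> makes the first corner an instance of the general one.\<close>

definition side_level :: "int \<Rightarrow> nat \<Rightarrow> int" where
  "side_level m j = (if j = 0 then - 1 else 8 * m * 4 ^ j - 1)"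

text \<open>The set \<open>wall m i\<close> is side \<open>i + 1\<close>. It starts at the end of side \<open>i\<close>, where
  \<open>level i = side_level m i\<close> means \<open>level (i + 2) = side_level m (i + 1) - side_level m i\<close> up
  to rounding, and ends where it meets the line of side \<open>i + 2\<close>. The term \<open>- 2\<close> makes it overlap the previous
  side, so that rounding leaves no gap at the corner.\<close>

definition wall :: "int \<Rightarrow> nat \<Rightarrow> (int \<times> int) set" where
  "wall m i = {p \<in> honeycomb. level (Suc i) p = side_level m (Suc i) \<and>
     level (Suc (Suc i)) p \<in> {side_level m (Suc i) - side_level m i - 2..side_level m (Suc (Suc i))}}"

text \<open>The vertices of a side follow each other in steps of two levels, one vertex per turn. The
  starting times \<open>5 * m * 4 ^ (i + 1)\<close> leave a side more turns than it has vertices, since the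
  length of side \<open>i + 1\<close> is about \<open>13 * m * 4 ^ i\<close> vertices.\<close>

definition build_time :: "int \<Rightarrow> nat \<Rightarrow> int \<times> int \<Rightarrow> int" where
  "build_time m i p = 5 * m * 4 ^ Suc i +
     (level (Suc (Suc i)) p - (side_level m (Suc i) - side_level m i - 2)) div 2"

text \<open>The part of the channel outside side \<open>i + 1\<close>. It is cut off from its neighbours by the lines
  that continue sides \<open>i\<close> and \<open>i + 1\<close> beyond their ends, and is bounded outwards by the sides
  \<open>i + 7\<close> and \<open>i + 8\<close> of the next turn.\<close>

definition zone :: "int \<Rightarrow> nat \<Rightarrow> (int \<times> int) set" where
  "zone m i = {p \<in> honeycomb. level i p \<le> side_level m i \<and>
     side_level m (Suc i) < level (Suc i) p \<and> level (Suc i) p < side_level m (i + 7) \<and>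
     level (Suc (Suc i)) p < side_level m (i + 8)}"

text \<open>The innermost part, inside the first turn. Side \<open>1\<close> has a free end on the line
  \<open>level 0 = - 1\<close>. Beyond this line the sides \<open>1\<close> and \<open>2\<close> are no boundary; the next turn bounds
  the core there, with its sides \<open>6\<close> and \<open>7\<close>, whose levels coincide with levels \<open>0\<close> and \<open>1\<close>.\<close>

definition core :: "int \<Rightarrow> (int \<times> int) set" where
  "core m = {p \<in> honeycomb. (\<forall>k\<in>{3, 4, 5, 6, 7}. level k p < side_level m k) \<and>
     (level 0 p \<le> - 1 \<longrightarrow> level 1 p < side_level m 1 \<and> level 2 p < side_level m 2)}"

text \<open>The detour forced by the corners between side \<open>1\<close> and side \<open>i + 1\<close>.\<close>

definition delay :: "int \<Rightarrow> nat \<Rightarrow> int" where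
  "delay m i = (\<Sum>k<i. side_level m (Suc k))"

text \<open>The vertices that the fire may have reached by time \<open>t\<close>, if the distance from the centre counts
  as the arrival time in the core. Some wall vertices belong to this set.\<close>

definition fire :: "int \<Rightarrow> int \<Rightarrow> (int \<times> int) set" where
  "fire m t = {p \<in> core m. \<forall>k. level k p \<le> t} \<union>
     (\<Union>i. {p \<in> zone m i. level (Suc (Suc i)) p + delay m i \<le> t})"

lemma odd_side_level: "odd (side_level m j)"
  by (simp add: side_level_def)

text \<open>Expresses all sides next to a zone by one parameter, which turns the geometric
  comparisons below into linear arithmetic.\<close>

lemma side_level_bounds:
  assumes "m \<ge> 1"
  obtains q where "q = m * 4 ^ i" "q \<ge> m" "side_level m (Suc i) = 32 * q - 1"
    "side_level m (Suc (Suc i)) = 128 * q - 1" "side_level m (i + 6) = 32768 * q - 1"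
    "side_level m (i + 7) = 131072 * q - 1" "side_level m (i + 8) = 524288 * q - 1"
    "side_level m (i + 9) = 2097152 * q - 1"
    "side_level m i \<le> 8 * q - 1" "- 1 \<le> side_level m i"
proof -
  have pos: "(1::int) \<le> 4 ^ i" by simp
  have "m * 1 \<le> m * 4 ^ i" using assms pos by (intro mult_left_mono) auto
  moreover have "0 \<le> m * 4 ^ i" using assms by simp
  then have "- 1 < 8 * m * 4 ^ i" by linarith
  ultimately show thesis
    using assms by (intro that[of "m * 4 ^ i"]) (auto simp: side_level_def power_add)
qed

section \<open>Spread of the fire along the channel\<close>

text \<open>Levels change by one, so an edge that leaves a zone starts or ends exactly on a boundary line.
  On the outer lines and on the inner line before its corner there is a wall; past the corner lies
  the next zone, and the line of side \<open>i\<close> leads back to the previous zone or to the core.\<close>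

lemma zone_step:
  assumes m: "m \<ge> 1" and x: "x \<in> zone m i" and adj: "hex_adj x y"
  obtains (wall) k where "y \<in> wall m k"
    | (stay) "y \<in> zone m i"
    | (forward) "y \<in> zone m (Suc i)" "level (Suc i) y = side_level m (Suc i)"
    | (backward) "level i x = side_level m i" "level i y = side_level m i + 1" "y \<in> honeycomb"
        "side_level m (Suc i) \<le> level (Suc i) y" "level (Suc i) y < side_level m (i + 7)"
        "level (Suc (Suc i)) y < side_level m (i + 8)"
proof -
  let ?h = "side_level m"
  obtain q where q: "q \<ge> m" and h: "?h (Suc i) = 32 * q - 1" "?h (Suc (Suc i)) = 128 * q - 1"
    "?h (i + 6) = 32768 * q - 1" "?h (i + 7) = 131072 * q - 1" "?h (i + 8) = 524288 * q - 1"
    "?h (i + 9) = 2097152 * q - 1" and hi: "?h i \<le> 8 * q - 1" "- 1 \<le> ?h i"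
    using side_level_bounds[OF m, of i] by blast
  have y: "y \<in> honeycomb" using adj by (simp add: hex_adj_def)
  define a b c d where "a = level i y" and "b = level (Suc i) y" and "c = level (Suc (Suc i)) y"
    and "d = level (Suc (Suc (Suc i))) y"
  note abcd = a_def b_def c_def d_def
  have sums: "b = a + c + (if odd a then 0 else 1)" "c = b + d + (if odd b then 0 else 1)"
    and par: "odd b \<longleftrightarrow> even a"
    unfolding abcd by (rule level_sum[OF y] level_parity[OF y])+
  have sb: "b - a - 1 \<le> c" "c \<le> b - a" "even a \<Longrightarrow> c = b - a - 1"
    "c - b - 1 \<le> d" "d \<le> c - b" "odd b \<Longrightarrow> d = c - b"
  proof -
    define \<epsilon> \<eta> :: int where "\<epsilon> = (if odd a then 0 else 1)" and "\<eta> = (if odd b then 0 else 1)"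
    have "0 \<le> \<epsilon>" "\<epsilon> \<le> 1" "even a \<Longrightarrow> \<epsilon> = 1" "0 \<le> \<eta>" "\<eta> \<le> 1" "odd b \<Longrightarrow> \<eta> = 0"
      by (simp_all add: \<epsilon>_def \<eta>_def)
    moreover have "b = a + c + \<epsilon>" "c = b + d + \<eta>"
      unfolding \<epsilon>_def \<eta>_def by (fact sums)+
    ultimately show "b - a - 1 \<le> c" "c \<le> b - a" "even a \<Longrightarrow> c = b - a - 1"
      "c - b - 1 \<le> d" "d \<le> c - b" "odd b \<Longrightarrow> d = c - b"
      by linarith+
  qed
  have steps: "\<bar>a - level i x\<bar> = 1" "\<bar>b - level (Suc i) x\<bar> = 1" "\<bar>c - level (Suc (Suc i)) x\<bar> = 1"
    using level_step[OF adj] by (simp_all add: abcd)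
  have zx: "level i x \<le> ?h i" "?h (Suc i) < level (Suc i) x" "level (Suc i) x < ?h (i + 7)"
    "level (Suc (Suc i)) x < ?h (i + 8)"
    using x by (simp_all add: zone_def)
  have y_le: "a \<le> ?h i + 1" "?h (Suc i) \<le> b" "b \<le> ?h (i + 7)" "c \<le> ?h (i + 8)"
    using zx steps by linarith+
  have odds: "odd (?h i)" "odd (?h (i + 7))" "odd (?h (i + 8))" "odd (?h (Suc i))"
    by (rule odd_side_level)+
  have per: "level (Suc (i + 6)) y = b" "level (Suc (Suc (i + 6))) y = c"
    "level (Suc (i + 7)) y = c" "level (Suc (Suc (i + 7))) y = d"
    using level_period[of "Suc i" y] level_period[of "Suc (Suc i)" y]
      level_period[of "Suc (Suc (Suc i))" y]
    by (simp_all add: abcd add.commute)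
  have idx: "Suc (i + 6) = i + 7" "Suc (i + 7) = i + 8" "Suc (i + 8) = i + 9" by simp_all
  have per: "level (i + 7) y = b" "level (i + 8) y = c" "level (i + 9) y = d"
    using per by (simp_all add: idx)
  have wallI: "y \<in> wall m k"
    if "level (Suc k) y = ?h (Suc k)" "?h (Suc k) - ?h k - 2 \<le> level (Suc (Suc k)) y"
      "level (Suc (Suc k)) y \<le> ?h (Suc (Suc k))" for k
    using that y by (simp add: wall_def)
  consider (outer) "c = ?h (i + 8)" | (outer') "b = ?h (i + 7)" "c < ?h (i + 8)"
    | (inner) "b = ?h (Suc i)" "c \<le> ?h (Suc (Suc i))" "c < ?h (i + 8)"
    | (turn) "b = ?h (Suc i)" "?h (Suc (Suc i)) < c" "c < ?h (i + 8)" "b < ?h (i + 7)"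
    | (retreat) "a = ?h i + 1" "?h (Suc i) < b" "b < ?h (i + 7)" "c < ?h (i + 8)"
    | (rest) "a \<le> ?h i" "?h (Suc i) < b" "b < ?h (i + 7)" "c < ?h (i + 8)"
  proof -
    have "a \<le> ?h i \<or> a = ?h i + 1" "?h (Suc i) < b \<or> b = ?h (Suc i)"
      "b < ?h (i + 7) \<or> b = ?h (i + 7)" "c < ?h (i + 8) \<or> c = ?h (i + 8)"
      "c \<le> ?h (Suc (Suc i)) \<or> ?h (Suc (Suc i)) < c"
      using y_le by auto
    then show thesis
      using outer outer' inner turn retreat rest by blast
  qed
  then show thesis
  proof cases
    case outer
    have "y \<in> wall m (i + 7)"
      by (rule wallI; unfold idx per) (use outer sb y_le h hi m q in linarith)+
    then show thesis by (rule wall)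
  next
    case outer'
    have "y \<in> wall m (i + 6)"
      by (rule wallI; unfold idx per) (use outer' sb y_le h hi m q in linarith)+
    then show thesis by (rule wall)
  next
    case inner
    have "even a" using inner par odds by simp
    have "y \<in> wall m i"
      by (rule wallI; unfold abcd[symmetric]) (use inner sb(3)[OF \<open>even a\<close>] y_le in linarith)+
    then show thesis by (rule wall)
  next
    case turn
    have d: "d = c - b" using sb(6) turn(1) odds(4) by simp
    have "y \<in> zone m (Suc i)"
      unfolding zone_def mem_Collect_eq abcd[symmetric] add_Suc idx
      using y by (intro conjI) (use turn d h hi m q in linarith)+
    then show thesis using turn forward by (simp add: abcd)
  next
    case retreat
    have "level i x = side_level m i" using retreat steps zx by linarith
    then show thesis using retreat y backward by (simp add: abcd)
  next
    case rest
    then show thesis using y stay by (simp add: zone_def abcd)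
  qed
qed

text \<open>The same inspection for the core, which is left only through the gap between the free end of the
  spiral and the side six steps later, that is, into zone \<open>0\<close>.\<close>

lemma core_step:
  assumes m: "m \<ge> 1" and x: "x \<in> core m" and adj: "hex_adj x y"
  obtains (wall) k where "y \<in> wall m k"
    | (stay) "y \<in> core m"
    | (forward) "y \<in> zone m 0"
proof -
  let ?h = "side_level m"
  have h: "?h 0 = - 1" "?h 1 = 32 * m - 1" "?h 2 = 128 * m - 1" "?h 3 = 512 * m - 1"
    "?h 4 = 2048 * m - 1" "?h 5 = 8192 * m - 1" "?h 6 = 32768 * m - 1" "?h 7 = 131072 * m - 1"
    "?h 8 = 524288 * m - 1"
    by (simp_all add: side_level_def)
  have y: "y \<in> honeycomb" using adj by (simp add: hex_adj_def)
  define a b c where "a = level 0 y" and "b = level 1 y" and "c = level 2 y"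
  note abc = a_def b_def c_def
  have per: "level 3 y = - 1 - a" "level 4 y = - 1 - b" "level 5 y = - 1 - c"
    "level 6 y = a" "level 7 y = b" "level 8 y = c"
    using level_opposite[OF y, of 0] level_opposite[OF y, of 1] level_opposite[OF y, of 2]
      level_period[of 0 y] level_period[of 1 y] level_period[of 2 y]
    by (simp_all add: abc)
  have par: "odd b \<longleftrightarrow> even a"
    using level_parity[OF y, of 0] by (simp add: abc)
  have "b = a + c + (if odd a then 0 else 1)"
    unfolding abc One_nat_def numeral_2_eq_2 by (rule level_sum[OF y])
  then have sum: "b - a - 1 \<le> c" "c \<le> b - a" "odd b \<Longrightarrow> c = b - a - 1" "odd a \<Longrightarrow> c = b - a"
    using par by (cases "odd a"; simp)+
  have opp: "level 3 x = - 1 - level 0 x" "level 4 x = - 1 - level 1 x" "level 5 x = - 1 - level 2 x"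
    "level 6 x = level 0 x" "level 7 x = level 1 x"
  proof -
    have "x \<in> honeycomb" using adj by (simp add: hex_adj_def)
    then show "level 3 x = - 1 - level 0 x" "level 4 x = - 1 - level 1 x" "level 5 x = - 1 - level 2 x"
      "level 6 x = level 0 x" "level 7 x = level 1 x"
      using level_opposite[of x 0] level_opposite[of x 1] level_opposite[of x 2]
        level_period[of 0 x] level_period[of 1 x] by simp_all
  qed
  have steps: "\<bar>a - level 0 x\<bar> = 1" "\<bar>b - level 1 x\<bar> = 1" "\<bar>c - level 2 x\<bar> = 1"
    using level_step[OF adj] by (simp_all add: abc)
  have cx: "- 1 - level 0 x < ?h 3" "- 1 - level 1 x < ?h 4" "- 1 - level 2 x < ?h 5"
    "level 0 x < ?h 6" "level 1 x < ?h 7"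
    and cx': "level 0 x \<le> - 1 \<longrightarrow> level 1 x < ?h 1 \<and> level 2 x < ?h 2"
    using x opp by (simp_all add: core_def)
  have y_le: "- 1 - a \<le> ?h 3" "- 1 - b \<le> ?h 4" "- 1 - c \<le> ?h 5" "a \<le> ?h 6" "b \<le> ?h 7"
    using cx steps by linarith+
  have odds: "odd (?h k)" for k by (rule odd_side_level)
  have wallI: "y \<in> wall m k"
    if "level (Suc k) y = ?h (Suc k)" "?h (Suc k) - ?h k - 2 \<le> level (Suc (Suc k)) y"
      "level (Suc (Suc k)) y \<le> ?h (Suc (Suc k))" for k
    using that y by (simp add: wall_def)
  consider (side7) "b = ?h 7" | (side6) "a = ?h 6" "b < ?h 7" | (side5) "- 1 - c = ?h 5"
    | (side4) "- 1 - b = ?h 4" | (side3) "- 1 - a = ?h 3"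
    | (inside) "- 1 - a < ?h 3" "- 1 - b < ?h 4" "- 1 - c < ?h 5" "a < ?h 6" "b < ?h 7"
    using y_le by (meson order_le_imp_less_or_eq)
  then show thesis
  proof cases
    case side7
    then show thesis
      using wallI[of 6] wall sum(1,2) per y_le cx' steps h m by simp
  next
    case side6
    then show thesis
      using wallI[of 5] wall sum(1,2) per y_le steps h m by simp
  next
    case side5
    then show thesis
      using wallI[of 4] wall sum(1,2) per y_le steps h m by simp
  next
    case side4
    then show thesis
      using wallI[of 3] wall sum(1,2) per y_le steps h m by simp
  next
    case side3
    then have "level 2 x < ?h 2" using cx' steps h m by linarith
    then have "c \<le> ?h 2" using steps by linarith
    then show thesis
      using wallI[of 2] wall side3 sum(1,2) per y_le steps h m by (simp add: abc)
  next
    case inside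
    show thesis
    proof (cases "a \<le> - 1")
      case False
      then have "y \<in> core m" using inside y per by (simp add: core_def abc)
      then show thesis by (rule stay)
    next
      case a: True
      consider (old) "level 0 x \<le> - 1" | (new) "level 0 x = 0" "a = - 1" using a steps by linarith
      then show thesis
      proof cases
        case old
        then have le: "b \<le> ?h 1" "c \<le> ?h 2" using cx' steps by linarith+
        consider "c = ?h 2" | "b = ?h 1" "c \<le> ?h 2" | "b < ?h 1" "c < ?h 2" using le by linarith
        then show thesis
        proof cases
          case 1
          have "y \<in> wall m 1"
            using wallI[of 1] 1 le sum(1,2) inside per h m a
            by (simp add: abc numeral_2_eq_2[symmetric])
          then show thesis by (rule wall)
        next
          case 2
          have "y \<in> wall m 0"
            using wallI[of 0] 2 sum(3) odds[of 1] h m a by (simp add: abc numeral_2_eq_2[symmetric])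
          then show thesis by (rule wall)
        next
          case 3
          then have "y \<in> core m" using inside y per by (simp add: core_def abc)
          then show thesis by (rule stay)
        qed
      next
        case new
        have c: "c = b + 1" using new sum(4) by simp
        consider "b < ?h 1" | "b = ?h 1" | "b > ?h 1" by linarith
        then show thesis
        proof cases
          case 1
          then have "y \<in> core m" using inside y per c h m by (simp add: core_def abc)
          then show thesis by (rule stay)
        next
          case 2
          have "y \<in> wall m 0"
            using wallI[of 0] 2 c h m by (simp add: abc numeral_2_eq_2[symmetric])
          then show thesis by (rule wall)
        next
          case 3
          have "y \<in> zone m 0"
            using 3 new c inside y h m by (simp add: zone_def abc numeral_2_eq_2[symmetric])
          then show thesis by (rule forward)
        qed
      qed
    qed
  qed
qed

lemma delay_ge:
  assumes "m \<ge> 1"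
  shows "max 0 (side_level m i) \<le> delay m i"
proof -
  have pos: "0 \<le> side_level m (Suc k)" for k
    by (rule side_level_bounds[OF assms, of k]) (use assms in linarith)
  then have nonneg: "0 \<le> delay m k" for k
    unfolding delay_def by (intro sum_nonneg) simp
  show ?thesis
  proof (cases i)
    case 0 then show ?thesis by (simp add: side_level_def delay_def)
  next
    case (Suc k) then show ?thesis using nonneg[of k] pos[of k] by (simp add: delay_def)
  qed
qed

text \<open>In a zone all levels are controlled by the one that measures progress; only \<open>level (i + 1)\<close> can
  exceed it, by at most the distance of side \<open>i\<close>. As the delay is at least that distance, the
  confined fire is nowhere ahead of an unhindered one.\<close>

lemma zone_level_le:
  assumes m: "m \<ge> 1" and p: "p \<in> zone m i"
  shows "level k p \<le> max 0 (side_level m i) + level (Suc (Suc i)) p"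
    and "level k p < side_level m (i + 8)"
proof -
  let ?h = "side_level m"
  obtain q where q: "q \<ge> m" and h: "?h (Suc i) = 32 * q - 1" "?h (Suc (Suc i)) = 128 * q - 1"
    "?h (i + 6) = 32768 * q - 1" "?h (i + 7) = 131072 * q - 1" "?h (i + 8) = 524288 * q - 1"
    "?h (i + 9) = 2097152 * q - 1" and hi: "?h i \<le> 8 * q - 1" "- 1 \<le> ?h i"
    using side_level_bounds[OF m, of i] by blast
  define a b c where "a = level i p" and "b = level (Suc i) p" and "c = level (Suc (Suc i)) p"
  note abc = a_def b_def c_def
  have hc: "p \<in> honeycomb" using p by (simp add: zone_def)
  have sum: "b = a + c + (if odd a then 0 else 1)"
    unfolding abc by (rule level_sum[OF hc])
  then have sb: "b - a - 1 \<le> c" "c \<le> b - a"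
    by (cases "odd a"; simp)+
  have z: "a \<le> ?h i" "?h (Suc i) < b" "b < ?h (i + 7)" "c < ?h (i + 8)"
    using p by (simp_all add: zone_def abc)
  have "even a \<Longrightarrow> a \<noteq> ?h i" using odd_side_level by metis
  then have "even a \<Longrightarrow> a + 1 \<le> ?h i" using z(1) by simp
  then have bc: "b \<le> ?h i + c" using sum z(1) by (cases "odd a"; simp)
  have c: "c \<ge> 0" "- 1 - a \<le> c" "- 1 - b \<le> c" using bc z h hi m q sb by linarith+
  have "\<forall>k. level k p \<le> max 0 (?h i) + c"
    unfolding level_le_iff_window[OF hc, of _ i] using bc c z hi by (simp add: abc[symmetric]; linarith)
  then show "level k p \<le> max 0 (?h i) + level (Suc (Suc i)) p" by (simp add: c_def)
  have "\<forall>k. level k p \<le> ?h (i + 8) - 1"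
    unfolding level_le_iff_window[OF hc, of _ i] using bc c z h hi m q by (simp add: abc[symmetric])
  then show "level k p < side_level m (i + 8)" by (simp add: zle_diff1_eq)
qed

lemma fire_mono: "t \<le> t' \<Longrightarrow> fire m t \<subseteq> fire m t'"
  unfolding fire_def by (intro Un_mono UN_mono Collect_mono impI) (auto intro: order_trans)

lemma level_le_fire:
  assumes m: "m \<ge> 1" and p: "p \<in> fire m t"
  shows "level k p \<le> t"
  using p unfolding fire_def
proof (elim UnE UN_E)
  fix i assume "p \<in> {p \<in> zone m i. level (Suc (Suc i)) p + delay m i \<le> t}"
  then have "p \<in> zone m i" "level (Suc (Suc i)) p + delay m i \<le> t" by simp_all
  then show ?thesis using zone_level_le(1)[OF m, of p i k] delay_ge[OF m, of i] by linarith
qed simp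

text \<open>On the line between two zones the two candidate arrival times agree, because the
  additional delay is the level of that line. So the arrival time grows by at most one along each
  edge within the channel.\<close>

lemma fire_step:
  assumes m: "m \<ge> 1" and p: "p \<in> fire m t" and adj: "hex_adj p q"
  shows "q \<in> fire m (t + 1) \<or> (\<exists>i. q \<in> wall m i)"
proof -
  have step: "\<bar>level k q - level k p\<bar> = 1" for k using level_step[OF adj] .
  have le: "level k q \<le> t + 1" for k
    using level_le_fire[OF m p, of k] step[of k] by linarith
  have core: "q \<in> fire m (t + 1)" if "q \<in> core m"
    using that le by (simp add: fire_def)
  have zone: "q \<in> fire m (t + 1)" if "q \<in> zone m i" "level (Suc (Suc i)) q + delay m i \<le> t + 1" for i
    using that unfolding fire_def by blast
  from p consider "p \<in> core m" | i where "p \<in> zone m i" "level (Suc (Suc i)) p + delay m i \<le> t"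
    unfolding fire_def by blast
  then show ?thesis
  proof cases
    case 1
    from m this adj show ?thesis
    proof (cases rule: core_step)
      case forward
      moreover have "level (Suc (Suc 0)) q + delay m 0 \<le> t + 1"
        using le by (simp add: delay_def)
      ultimately show ?thesis using zone by blast
    qed (use core in blast)+
  next
    case (2 i)
    have hp: "p \<in> honeycomb" using adj by (simp add: hex_adj_def)
    from m 2(1) adj show ?thesis
    proof (cases rule: zone_step)
      case stay
      then show ?thesis using zone 2(2) step[of "Suc (Suc i)"] by auto
    next
      case forward
      have q: "q \<in> honeycomb" using adj by (simp add: hex_adj_def)
      have "odd (level (Suc i) q)" using forward odd_side_level by simp
      then have "level (Suc (Suc i)) q = level (Suc i) q + level (Suc (Suc (Suc i))) q"
        using level_sum[OF q, of "Suc i"] by simp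
      then have "level (Suc (Suc (Suc i))) q + delay m (Suc i) = level (Suc (Suc i)) q + delay m i"
        using forward(2) by (simp add: delay_def)
      then show ?thesis using zone[OF forward(1)] 2(2) step[of "Suc (Suc i)"] by linarith
    next
      case backward
      obtain r where r: "r \<ge> m" "side_level m (Suc i) = 32 * r - 1"
        "side_level m i \<le> 8 * r - 1" "- 1 \<le> side_level m i"
        "side_level m (i + 6) = 32768 * r - 1" "side_level m (i + 7) = 131072 * r - 1"
        using side_level_bounds[OF m, of i] by metis
      note q = backward(3)
      have "level (Suc i) q = level i q + level (Suc (Suc i)) q + (if odd (level i q) then 0 else 1)"
        by (rule level_sum[OF q])
      then have qsum: "level (Suc i) q \<le> level i q + level (Suc (Suc i)) q + 1"
        by (cases "odd (level i q)"; simp)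
      have sum: "level (Suc i) p = level i p + level (Suc (Suc i)) p"
        using level_sum[OF hp, of i] backward(1) odd_side_level by simp
      show ?thesis
      proof (cases i)
        case 0
        have "level 3 q = - 1 - level 0 q" "level 4 q = - 1 - level 1 q" "level 5 q = - 1 - level 2 q"
          "level 6 q = level 0 q" "level 7 q = level 1 q"
          using level_opposite[OF q, of 0] level_opposite[OF q, of 1] level_opposite[OF q, of 2]
            level_period[of 0 q] level_period[of 1 q] by simp_all
        moreover have "side_level m 0 = - 1" "side_level m 1 = 32 * m - 1" "side_level m 3 = 512 * m - 1"
          "side_level m 4 = 2048 * m - 1" "side_level m 5 = 8192 * m - 1"
          "side_level m 6 = 32768 * m - 1"
          by (simp_all add: side_level_def)
        ultimately have "q \<in> core m"
          using backward 0 q m qsum by (simp add: core_def numeral_2_eq_2[symmetric])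
        then show ?thesis using core by blast
      next
        case (Suc j)
        have "level (Suc j) q = level j q + level (Suc (Suc j)) q + (if odd (level j q) then 0 else 1)"
          by (rule level_sum[OF q])
        then have "level j q \<le> level i q - level (Suc i) q"
          by (cases "odd (level j q)"; simp add: Suc)
        then have "level j q \<le> - 1" using backward r m by linarith
        moreover have "- 1 \<le> side_level m j" by (rule side_level_bounds[OF m, of j])
        moreover have "level i q < side_level m (i + 6)" using backward r m by linarith
        ultimately have "q \<in> zone m j"
          using backward q unfolding zone_def mem_Collect_eq Suc by (simp add: add.commute)
        moreover have "level (Suc (Suc j)) q + delay m j \<le> t + 1"
          using sum 2(2) backward(1) step[of "Suc i"] by (simp add: Suc delay_def)
        ultimately show ?thesis using zone by blast
      qed
    qed blast
  qed
qed

section \<open>Timing of the wall\<close>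

text \<open>Put \<open>s = m * 4 ^ i\<close> and let \<open>c = level (i + 2)\<close> at a vertex of the side. It is protected
  by turn \<open>8 * s + c / 2 + 1\<close>, whereas the fire needs about \<open>max (32 * s) c\<close> turns. The
  difference is about a quarter of that maximum or more, which pays for the head start \<open>r\<close>.\<close>

lemma build_time_le:
  assumes m: "m \<ge> 1" "m \<ge> r" and p: "p \<in> fire m (t + r)" and adj: "hex_adj p q" and q: "q \<in> wall m i"
  shows "build_time m i q \<le> t + 1"
proof -
  obtain s where s: "s = m * 4 ^ i" "s \<ge> m" "side_level m (Suc i) = 32 * s - 1"
    "side_level m i \<le> 8 * s - 1" "- 1 \<le> side_level m i"
    using side_level_bounds[OF m(1), of i] by metis
  have le: "level k q \<le> t + r + 1" for k
    using level_le_fire[OF m(1) p, of k] level_step[OF adj, of k] by linarith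
  define c where "c = level (Suc (Suc i)) q"
  have "32 * s - 1 \<le> t + r + 1" "c \<le> t + r + 1"
    using le[of "Suc i"] le[of "Suc (Suc i)"] q s by (simp_all add: wall_def c_def)
  moreover have "build_time m i q = 20 * s + (c - (32 * s - 1 - side_level m i - 2)) div 2"
    by (simp add: build_time_def s c_def)
  moreover have "2 * ((c - (32 * s - 1 - side_level m i - 2)) div 2) \<le> c - (32 * s - 1 - side_level m i - 2)"
    by simp
  ultimately show ?thesis using s m by linarith
qed

lemma build_time_bounds:
  assumes m: "m \<ge> 1" and q: "q \<in> wall m i"
  shows "20 * (m * 4 ^ i) \<le> build_time m i q" "build_time m i q < 80 * (m * 4 ^ i)"
proof -
  obtain s where s: "s = m * 4 ^ i" "s \<ge> m" "side_level m (Suc i) = 32 * s - 1"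
    "side_level m (Suc (Suc i)) = 128 * s - 1"
    "side_level m i \<le> 8 * s - 1" "- 1 \<le> side_level m i"
    using side_level_bounds[OF m, of i] by metis
  define c where "c = level (Suc (Suc i)) q - (32 * s - 1 - side_level m i - 2)"
  have "0 \<le> c" "c \<le> 104 * s + 1" using q s by (simp_all add: wall_def c_def)
  then have "0 \<le> c div 2" "c div 2 \<le> 53 * s" using s m by linarith+
  moreover have "build_time m i q = 20 * s + c div 2"
    by (simp add: build_time_def s c_def)
  ultimately show "20 * (m * 4 ^ i) \<le> build_time m i q" "build_time m i q < 80 * (m * 4 ^ i)"
    unfolding s(1)[symmetric] using s m by linarith+
qed

text \<open>One protection per turn suffices: the time intervals of different sides are disjoint, and two
  vertices of one side differ by at least two levels.\<close>

lemma build_time_inject: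
  assumes m: "m \<ge> 1" and p: "p \<in> wall m i" and q: "q \<in> wall m j"
    and eq: "build_time m i p = build_time m j q"
  shows "p = q"
proof -
  have less: False if "i < j" "p \<in> wall m i" "q \<in> wall m j" "build_time m i p = build_time m j q"
    for i j p q
  proof -
    have "(4::int) ^ Suc i \<le> 4 ^ j" using that(1) by (intro power_increasing) auto
    then have "m * 4 ^ Suc i \<le> m * 4 ^ j" using m by (intro mult_left_mono) auto
    then show False
      using build_time_bounds[OF m that(2)] build_time_bounds[OF m that(3)] that(4) by simp
  qed
  have ij: "i = j" using less[of i j p q] less[of j i q p] p q eq by (metis nat_neq_iff)
  define s where "s = side_level m (Suc i) - side_level m i - 2"
  have hc: "p \<in> honeycomb" "q \<in> honeycomb" using p q by (simp_all add: wall_def)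
  have l: "level (Suc i) p = level (Suc i) q" using p q ij by (simp add: wall_def)
  have ev: "even (level (Suc (Suc i)) p - s)" "even (level (Suc (Suc i)) q - s)"
    using level_parity[OF hc(1), of "Suc i"] level_parity[OF hc(2), of "Suc i"] p q ij
      odd_side_level[of m] by (simp_all add: wall_def s_def)
  moreover have "(level (Suc (Suc i)) p - s) div 2 = (level (Suc (Suc i)) q - s) div 2"
    using eq ij by (simp add: build_time_def s_def)
  ultimately have "level (Suc (Suc i)) p = level (Suc (Suc i)) q" 
    by (elim evenE) simp
  then show ?thesis using level_inject[OF hc l] by simp
qed

section \<open>The fire falls behind\<close>

text \<open>In zone \<open>i\<close> the arrival time exceeds the distance by at least the sum of the side distances
  before side \<open>i\<close>, in particular by that of side \<open>i - 1\<close>. The zone is enclosed by side \<open>i + 8\<close>,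
  which is \<open>4 ^ 9\<close> times as far from the centre as side \<open>i - 1\<close>. The term \<open>8 * m\<close> absorbs the
  core and the first zones, where no such delay exists yet.\<close>

lemma fire_retarded:
  assumes m: "m \<ge> 1" and p: "p \<in> fire m t"
  shows "(4 ^ 9 + 1) * level k p \<le> 4 ^ 9 * (t + 8 * m)"
proof -
  let ?h = "side_level m"
  from p consider "p \<in> core m" | i where "p \<in> zone m i" "level (Suc (Suc i)) p + delay m i \<le> t"
    unfolding fire_def by blast
  then show ?thesis
  proof cases
    case 1
    have hc: "p \<in> honeycomb" using 1 by (simp add: core_def)
    have h: "?h 0 = - 1" "?h 1 = 32 * m - 1" "?h 2 = 128 * m - 1" "?h 3 = 512 * m - 1"
      "?h 4 = 2048 * m - 1" "?h 5 = 8192 * m - 1" "?h 6 = 32768 * m - 1" "?h 7 = 131072 * m - 1"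
      by (simp_all add: side_level_def)
    have opp: "level 3 p = - 1 - level 0 p" "level 4 p = - 1 - level 1 p" "level 5 p = - 1 - level 2 p"
      "level 6 p = level 0 p" "level 7 p = level 1 p"
      using level_opposite[OF hc, of 0] level_opposite[OF hc, of 1] level_opposite[OF hc, of 2]
        level_period[of 0 p] level_period[of 1 p] by simp_all
    have "level 1 p = level 0 p + level 2 p + (if odd (level 0 p) then 0 else 1)"
      unfolding One_nat_def numeral_2_eq_2 by (rule level_sum[OF hc])
    then have c: "level 2 p \<le> level 1 p - level 0 p" by (cases "odd (level 0 p)"; simp)
    have "\<forall>k. level k p \<le> ?h 7"
      unfolding level_le_iff[OF hc] using 1 opp h m c
      by (cases "level 0 p \<le> - 1") (simp_all add: core_def)
    then have "level k p \<le> ?h 7" by blast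
    then show ?thesis using level_le_fire[OF m p, of k] h m by simp
  next
    case (2 i)
    define n where "n = level k p"
    have n: "n \<le> max 0 (?h i) + level (Suc (Suc i)) p" "n < ?h (i + 8)"
      using zone_level_le[OF m 2(1)] by (simp_all add: n_def)
    have "n \<le> 4 ^ 9 * (t - n + 8 * m)"
    proof (cases "i \<le> 1")
      case True
      then have "?h (i + 8) \<le> ?h 9" using m by (cases i) (auto simp: side_level_def)
      moreover have "n \<le> t" using n(1) 2(2) delay_ge[OF m, of i] by linarith
      ultimately show ?thesis using n(2) m by (simp add: side_level_def)
    next
      case False
      then obtain j where i: "i = Suc (Suc j)" by (metis One_nat_def not_less_eq_eq old.nat.exhaust le0)
      have "0 \<le> m * 4 ^ i" using m by simp
      then have "max 0 (?h i) = ?h i" using i m by (simp add: side_level_def)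
      then have "n + ?h (Suc j) \<le> t"
        using n(1) 2(2) delay_ge[OF m, of "Suc j"] by (simp add: i delay_def)
      then show ?thesis using n(2) m by (simp add: side_level_def i power_add)
    qed
    then show ?thesis by (simp add: n_def algebra_simps)
  qed
qed

lemma initial_fire:
  assumes m: "m > r" "r \<ge> 0" and p: "p \<in> honeycomb" "\<forall>k. level k p \<le> r"
  shows "p \<in> fire m r"
proof -
  have "r < side_level m k" if "k \<ge> 1" for k
  proof -
    have "m \<le> m * 4 ^ k" using m by simp
    then have "r < 8 * (m * 4 ^ k) - 1" using m by linarith
    then show ?thesis using that by (simp add: side_level_def mult.assoc)
  qed
  then have "level k p < side_level m k" if "k \<ge> 1" for k
    using p(2) that by (meson order_le_less_trans)
  then have "p \<in> core m" using p(1) by (simp add: core_def)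
  then show ?thesis using p(2) by (simp add: fire_def)
qed

lemma wall_nonempty: "m \<ge> 1 \<Longrightarrow> (16 * m, 16 * m - 1) \<in> wall m 0"
  using level_values[of "16 * m - 1" 0] honeycomb_values(1)[of "16 * m - 1" 0]
  by (simp add: wall_def side_level_def numeral_2_eq_2[symmetric])

text \<open>In turns for which the schedule contains no vertex, an arbitrary wall vertex is chosen; as wall
  vertices never burn, this is always a legal move.\<close>

lemma spiral_strategy:
  assumes m: "m \<ge> 1" "m \<ge> r" and B: "B \<subseteq> eis ` (fire m r - (\<Union>i. wall m i))"
  obtains p where "strategy hex_vertices hex_edges B p"
    "\<And>t. burning hex_edges B p t \<subseteq> eis ` fire m (int t + r)"
proof -
  let ?W = "\<Union>i. wall m i"
  define p where "p t = eis (SOME q. q \<in> ?W \<and>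
      ((\<exists>i. \<exists>q\<in>wall m i. build_time m i q = int t) \<longrightarrow> (\<exists>i. q \<in> wall m i \<and> build_time m i q = int t)))"
    for t
  have p_some: "\<exists>q. p t = eis q \<and> q \<in> ?W \<and>
      ((\<exists>i. \<exists>q\<in>wall m i. build_time m i q = int t) \<longrightarrow> (\<exists>i. q \<in> wall m i \<and> build_time m i q = int t))"
    for t
  proof -
    have "\<exists>q. q \<in> ?W \<and>
      ((\<exists>i. \<exists>q\<in>wall m i. build_time m i q = int t) \<longrightarrow> (\<exists>i. q \<in> wall m i \<and> build_time m i q = int t))"
      using wall_nonempty[OF m(1)] by blast
    from someI_ex[OF this] show ?thesis unfolding p_def by blast
  qed
  have built: "eis q \<in> p ` {1..Suc t}" if q: "q \<in> wall m i" and le: "build_time m i q \<le> int (Suc t)" for q i t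
  proof -
    have "0 < m * 4 ^ i" using m by simp
    then have "0 < build_time m i q" using build_time_bounds(1)[OF m(1) q] by linarith
    then obtain s where s: "build_time m i q = int s" "0 < s"
      by (metis zero_less_imp_eq_int)
    then have s': "s \<in> {1..Suc t}" using le by simp
    then obtain q' j where "p s = eis q'" "q' \<in> wall m j" "build_time m j q' = int s"
      using p_some[of s] q s(1) by blast
    then have "p s = eis q" using build_time_inject[OF m(1) q] s(1) by metis
    then show ?thesis using s' by (metis image_eqI)
  qed
  have burn: "burning hex_edges B p t \<subseteq> eis ` (fire m (int t + r) - ?W)" for t
  proof (induction t)
    case 0 then show ?case using B by simp
  next
    case (Suc t)
    have mono: "fire m (int t + r) \<subseteq> fire m (int (Suc t) + r)" by (rule fire_mono) simp
    show ?case
    proof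
      fix x assume "x \<in> burning hex_edges B p (Suc t)"
      then consider "x \<in> burning hex_edges B p t"
        | y where "x \<notin> p ` {1..Suc t}" "y \<in> burning hex_edges B p t" "{y, x} \<in> hex_edges"
        by (auto simp: insert_commute)
      then show "x \<in> eis ` (fire m (int (Suc t) + r) - ?W)"
      proof cases
        case 1 then show ?thesis using Suc mono by blast
      next
        case (2 y)
        obtain q q' where q: "y = eis q" "x = eis q'" "hex_adj q q'" using 2(3) by (rule hex_edge_cases)
        have fq: "q \<in> fire m (int t + r)" using 2(2) Suc q(1) by auto
        have nW: "q' \<notin> ?W"
        proof
          assume "q' \<in> ?W"
          then obtain i where i: "q' \<in> wall m i" by blast
          have "build_time m i q' \<le> int (Suc t)"
            using build_time_le[OF m fq q(3) i] by simp
          then show False using built[OF i] 2(1) q(2) by blast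
        qed
        moreover have "q' \<in> fire m (int (Suc t) + r)"
          using fire_step[OF m(1) fq q(3)] nW by (simp add: algebra_simps)
        ultimately show ?thesis using q(2) by blast
      qed
    qed
  qed
  have "strategy hex_vertices hex_edges B p"
    unfolding strategy_def
  proof
    fix t
    obtain q where q: "p (Suc t) = eis q" "q \<in> ?W" using p_some[of "Suc t"] by blast
    then have "q \<in> honeycomb" by (auto simp: wall_def)
    moreover have "eis q \<notin> burning hex_edges B p t" using burn[of t] q(2) by auto
    ultimately show "p (Suc t) \<in> hex_vertices - burning hex_edges B p t"
      using q(1) by (simp add: hex_vertices_eis)
  qed
  then show thesis using that burn by blast
qed

theorem theorem4:
  "\<exists>c::real. c < 1 \<and>
     (\<forall>B. finite B \<and> B \<subseteq> hex_vertices \<longrightarrow>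
       (\<exists>v\<^sub>0\<in>hex_vertices. \<exists>p. strategy hex_vertices hex_edges B p \<and>
         (\<exists>T\<^sub>0. \<forall>T\<ge>T\<^sub>0. burning hex_edges B p T
                       \<subseteq> graph_nbhd hex_vertices hex_edges (c * real T) v\<^sub>0)))"
proof -
  \<comment> \<open>Distances are at most \<open>K / (K + 1) * T\<close> plus a constant; the midpoint between this factor and
    \<open>1\<close> absorbs the constant for large \<open>T\<close>.\<close>
  define K :: real where "K = 4 ^ 9"
  define c where "c = (K + 1/2) / (K + 1)"
  have "c < 1" by (simp add: c_def K_def)
  moreover have "\<exists>v\<^sub>0\<in>hex_vertices. \<exists>p. strategy hex_vertices hex_edges B p \<and>
         (\<exists>T\<^sub>0. \<forall>T\<ge>T\<^sub>0. burning hex_edges B p T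
                       \<subseteq> graph_nbhd hex_vertices hex_edges (c * real T) v\<^sub>0)"
    if B: "finite B" "B \<subseteq> hex_vertices" for B
  proof -
    obtain B' where B': "B' \<subseteq> honeycomb" "finite B'" "B = eis ` B'"
      using B finite_subset_image[of B eis honeycomb] unfolding hex_vertices_eis by blast
    define spread where "spread q = \<bar>level 0 q\<bar> + \<bar>level (Suc 0) q\<bar> + \<bar>level 2 q\<bar>" for q
    define r where "r = (\<Sum>q\<in>B'. spread q)"
    have r0: "0 \<le> r" unfolding r_def by (intro sum_nonneg) (simp add: spread_def)
    have level_r: "\<forall>k. level k q \<le> r" if "q \<in> B'" for q
    proof -
      have "spread q \<le> r" unfolding r_def
        using that B'(2) by (intro member_le_sum) (simp_all add: spread_def)
      then show ?thesis using B'(1) that unfolding spread_def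
        by (subst level_le_iff) auto
    qed
    define m where "m = r + 1"
    have m: "m \<ge> 1" "m \<ge> r" "m > r" using r0 by (simp_all add: m_def)
    have "B \<subseteq> eis ` (fire m r - (\<Union>i. wall m i))"
    proof -
      have "q \<in> fire m r - (\<Union>i. wall m i)" if "q \<in> B'" for q
      proof -
        have "q \<in> fire m r" using initial_fire[OF m(3) r0 _ level_r[OF that]] B'(1) that by blast
        moreover have "q \<notin> wall m i" for i
        proof
          assume "q \<in> wall m i"
          then have "side_level m (Suc i) \<le> r" using level_r[OF that, rule_format, of "Suc i"] by (simp add: wall_def)
          moreover have "r < side_level m (Suc i)"
            by (rule side_level_bounds[OF m(1), of i]) (use m r0 in linarith)
          ultimately show False by simp
        qed
        ultimately show ?thesis by blast
      qed
      then show ?thesis unfolding B'(3) by blast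
    qed
    from spiral_strategy[OF m(1,2) this] obtain p
      where p: "strategy hex_vertices hex_edges B p"
        "\<And>t. burning hex_edges B p t \<subseteq> eis ` fire m (int t + r)" by blast
    define s where "s = real_of_int (r + 8 * m) + 6"
    have "burning hex_edges B p T \<subseteq> graph_nbhd hex_vertices hex_edges (c * real T) (eis (1, 0))"
      if T: "T \<ge> nat \<lceil>2 * (K + 1) * s\<rceil>" for T
    proof
      fix x assume "x \<in> burning hex_edges B p T"
      then obtain q where q: "x = eis q" "q \<in> fire m (int T + r)" using p(2) by blast
      have hc: "q \<in> honeycomb" using q(2) by (auto simp: fire_def core_def zone_def)
      define n where "n = nat ((4 ^ 9 * (int T + r + 8 * m)) div (4 ^ 9 + 1))"
      have "level k q \<le> (4 ^ 9 * (int T + r + 8 * m)) div (4 ^ 9 + 1)" for k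
      proof -
        have "level k q * (4 ^ 9 + 1) \<le> 4 ^ 9 * (int T + r + 8 * m)"
          using fire_retarded[OF m(1) q(2), of k] by (simp add: mult.commute)
        from zdiv_mono1[OF this, of "4 ^ 9 + 1"] show ?thesis by simp
      qed
      moreover have n: "int n = (4 ^ 9 * (int T + r + 8 * m)) div (4 ^ 9 + 1)"
        using m(1) r0 by (simp add: n_def)
      ultimately have "\<forall>k. level k q \<le> int n" by simp
      then have "graph_dist hex_edges x (eis (1, 0)) \<le> enat (n + 6)"
        unfolding q(1) by (rule graph_dist_centre_le[OF hc])
      then have dist: "ereal_of_enat (graph_dist hex_edges x (eis (1, 0))) \<le> ereal (real (n + 6))"
        by (metis ereal_of_enat_le_iff ereal_of_enat_simps(1))
      have "int n * (4 ^ 9 + 1) \<le> 4 ^ 9 * (int T + r + 8 * m)" unfolding n by simp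
      then have "real_of_int (int n * (4 ^ 9 + 1)) \<le> real_of_int (4 ^ 9 * (int T + r + 8 * m))"
        by (simp only: of_int_le_iff)
      then have "real n * (K + 1) \<le> K * (real T + (s - 6))" by (simp add: K_def s_def)
      moreover have "2 * (K + 1) * s \<le> real T" using T by linarith
      moreover have "6 \<le> s" using r0 m(1) by (simp add: s_def)
      ultimately have "(real n + 6) * (K + 1) \<le> (K + 1/2) * real T"
        by (simp add: algebra_simps K_def)
      then have "real (n + 6) \<le> c * real T" by (simp add: c_def K_def field_simps)
      then have "ereal_of_enat (graph_dist hex_edges x (eis (1, 0))) \<le> ereal (c * real T)"
        using dist by (meson ereal_less_eq(3) order_trans)
      then show "x \<in> graph_nbhd hex_vertices hex_edges (c * real T) (eis (1, 0))"
        using hc q(1) by (simp add: graph_nbhd_def hex_vertices_eis)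
    qed
    moreover have "eis (1, 0) \<in> hex_vertices" by (simp add: hex_vertices_eis honeycomb_def)
    ultimately show ?thesis using p(1) by blast
  qed
  ultimately show ?thesis by blast
qed

end
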